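(* Let $X$ be a set and let $\mathcal G$ be a complete submodule of $\overline{\mathbb R}^X_{\max}$. The following statements are equivalent: (i) there exists a symmetric kernel $b:X\times X\to\overline{\mathbb R}$ such that $\mathcal G=\mathrm{Rg}(B)$; (ii) there exists a sesquilinear map $\bar F:\mathcal G\to\mathcal G$ such that $\bar F\bar F=\mathrm{Id}_{\mathcal G}$. If these properties hold, then $\bar F$ can be taken as the restriction to $\mathrm{Rg}(B)$ of the operator $\bar B$ associated with $b$.
   Context: $\overline{\mathbb R}=[-\infty,+\infty]$. The operation $+_\top$ extends addition to $\overline{\mathbb R}$ with $+\infty$ absorbing, $+_\bot$ with $-\infty$ absorbing, and $a-_\bot c:=a+_\bot(-c)$. $\overline{\mathbb R}^X_{\max}$ is the set of functions $X\to\overline{\mathbb R}$ with the pointwise $(\max,+)$ operations and the pointwise order. A subset $\mathcal G\subset\overline{\mathbb R}^X$ is a complete submodule of $\overline{\mathbb R}^X_{\max}$ if it is stable under arbitrary pointwise suprema (including the empty one, so that the constant $-\infty$ belongs to $\mathcal G$) and under addition of constants $f\mapsto f+\lambda$, $\lambda\in\mathbb R$. For a kernel $b:X\times X\to\overline{\mathbb R}$, $Bf(x)=\sup_{y\in X}b(x,y)+_\bot f(y)$ and $\bar Bf(x)=\sup_{y\in X}b(x,y)-_\bot f(y)$ for $f\in\overline{\mathbb R}^X$, $x\in X$; $\mathrm{Rg}(B)=\{Bf: f\in\overline{\mathbb R}^X\}=\{\bar Bf: f\in\overline{\mathbb R}^X\}$. The kernel is symmetric if $b(x,y)=b(y,x)$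 for all $x,y$. For a family $(g_i)_{i\in I}$ in $\mathcal G$, the infimum relative to $\mathcal G$ is $\inf^{\mathcal G}_i g_i:=\max\{g\in\mathcal G: g\le g_i\ \forall i\in I\}$. A map $\bar F:\mathcal G\to\mathcal G$ is sesquilinear if $\bar F(\inf^{\mathcal G}_{i\in I} g_i)=\sup_{i\in I}\bar F(g_i)$ for every finite nonempty family $(g_i)_{i\in I}$ in $\mathcal G$, and $\bar F(g+_\top\lambda)=\bar F(g)-_\bot\lambda$ for all $g\in\mathcal G$ and $\lambda\in\overline{\mathbb R}$ such that $g+_\top\lambda\in\mathcal G$. *)

theory Defs
  imports "HOL-Library.Extended_Real" "HOL-Library.FuncSet"
begin

text \<open>Addition on the type \<open>ereal\<close> has \<open>\<infinity>\<close> absorbing: \<open>\<infinity> + (-\<infinity>) = \<infinity>\<close>.\<close>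

abbreviation plus_top :: "ereal \<Rightarrow> ereal \<Rightarrow> ereal" (infixl "+\<^sub>\<top>" 65) where
  "a +\<^sub>\<top> c \<equiv> a + c"

definition plus_bot :: "ereal \<Rightarrow> ereal \<Rightarrow> ereal" (infixl "+\<^sub>\<bottom>" 65) where
  "a +\<^sub>\<bottom> c = (if a = -\<infinity> \<or> c = -\<infinity> then -\<infinity> else a + c)"

definition minus_bot :: "ereal \<Rightarrow> ereal \<Rightarrow> ereal" (infixl "-\<^sub>\<bottom>" 65) where
  "a -\<^sub>\<bottom> c = a +\<^sub>\<bottom> (- c)"

text \<open>A function from \<open>X\<close> to the extended reals is represented by the extensional function
  that equals \<open>undefined\<close> outside \<open>X\<close>. On such functions \<open>=\<close> and \<open>\<le>\<close> of the function type are
  equality on \<open>X\<close> and the pointwise order on \<open>X\<close>.\<close>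

abbreviation ext_funs :: "'a set \<Rightarrow> ('a \<Rightarrow> ereal) set" where
  "ext_funs X \<equiv> X \<rightarrow>\<^sub>E UNIV"

definition pointwise_Sup :: "'a set \<Rightarrow> ('a \<Rightarrow> ereal) set \<Rightarrow> 'a \<Rightarrow> ereal" where
  "pointwise_Sup X S = (\<lambda>x\<in>X. SUP f\<in>S. f x)"

definition complete_submodule :: "'a set \<Rightarrow> ('a \<Rightarrow> ereal) set \<Rightarrow> bool" where
  "complete_submodule X G \<longleftrightarrow>
     G \<subseteq> ext_funs X \<and>
     (\<forall>S. S \<subseteq> G \<longrightarrow> pointwise_Sup X S \<in> G) \<and>
     (\<forall>f\<in>G. \<forall>c::real. (\<lambda>x\<in>X. f x + ereal c) \<in> G)"

text \<open>Only the values of a kernel on \<open>X \<times> X\<close> matter.\<close>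

definition symmetric_kernel :: "'a set \<Rightarrow> ('a \<Rightarrow> 'a \<Rightarrow> ereal) \<Rightarrow> bool" where
  "symmetric_kernel X b \<longleftrightarrow> (\<forall>x\<in>X. \<forall>y\<in>X. b x y = b y x)"

definition kernel_op ::
    "'a set \<Rightarrow> ('a \<Rightarrow> 'a \<Rightarrow> ereal) \<Rightarrow> ('a \<Rightarrow> ereal) \<Rightarrow> 'a \<Rightarrow> ereal" where
  "kernel_op X b f = (\<lambda>x\<in>X. SUP y\<in>X. b x y +\<^sub>\<bottom> f y)"

definition kernel_op_bar ::
    "'a set \<Rightarrow> ('a \<Rightarrow> 'a \<Rightarrow> ereal) \<Rightarrow> ('a \<Rightarrow> ereal) \<Rightarrow> 'a \<Rightarrow> ereal" where
  "kernel_op_bar X b f = (\<lambda>x\<in>X. SUP y\<in>X. b x y -\<^sub>\<bottom> f y)"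

definition Rg :: "'a set \<Rightarrow> ('a \<Rightarrow> 'a \<Rightarrow> ereal) \<Rightarrow> ('a \<Rightarrow> ereal) set" where
  "Rg X b = kernel_op X b ` ext_funs X"

text \<open>The infimum relative to \<open>G\<close> of a family depends only on the set \<open>S\<close> of its members. For
  \<open>G\<close> a complete submodule and \<open>S \<subseteq> G\<close> the greatest element exists.\<close>

definition rel_Inf :: "('a \<Rightarrow> ereal) set \<Rightarrow> ('a \<Rightarrow> ereal) set \<Rightarrow> 'a \<Rightarrow> ereal" where
  "rel_Inf G S = (GREATEST g. g \<in> G \<and> (\<forall>h\<in>S. g \<le> h))"

definition sesquilinear ::
    "'a set \<Rightarrow> ('a \<Rightarrow> ereal) set \<Rightarrow> (('a \<Rightarrow> ereal) \<Rightarrow> 'a \<Rightarrow> ereal) \<Rightarrow> bool" where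
  "sesquilinear X G F \<longleftrightarrow>
     F \<in> G \<rightarrow> G \<and>
     (\<forall>S. finite S \<and> S \<noteq> {} \<and> S \<subseteq> G \<longrightarrow> F (rel_Inf G S) = pointwise_Sup X (F ` S)) \<and>
     (\<forall>g\<in>G. \<forall>c::ereal. (\<lambda>x\<in>X. g x +\<^sub>\<top> c) \<in> G \<longrightarrow>
        F (\<lambda>x\<in>X. g x +\<^sub>\<top> c) = (\<lambda>x\<in>X. F g x -\<^sub>\<bottom> c))"

end

theory Submission imports Defs begin

text \<open>
  The operator \<open>\<lambda>f. kernel_op_bar X b f\<close> of a symmetric kernel is adjoint to itself for the
  pointwise order: \<open>kernel_op_bar X b f \<le> g\<close> says that \<open>b x y \<le> f y +\<^sub>\<top> g x\<close> for all \<open>x\<close>, \<open>y\<close>, a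
  condition that is symmetric in \<open>f\<close> and \<open>g\<close>. Like every self-adjoint antitone map, it is therefore an
  order-reversing involution of its own range, and such an involution turns relative infima into
  suprema. Compatibility with the addition of constants is a computation in the extended reals.

  For the converse, sesquilinearity on pairs makes an involutive \<open>F\<close> order-reversing. If
  \<open>F\<close> came from a kernel \<open>b\<close>, then the column \<open>\<lambda>x. b x y\<close> would be the image of the function that is
  \<open>0\<close> at \<open>y\<close> and \<open>\<infinity>\<close> elsewhere. That function need not lie in \<open>G\<close>, but its greatest minorant in \<open>G\<close>,
  here called the peak at \<open>y\<close>, has the same image, so the kernel has to be
  \<open>b x y = F (peak y) x\<close>. The peaks represent evaluation: a member \<open>g\<close> of \<open>G\<close> lies below
  \<open>peak y + l\<close> exactly when \<open>g y \<le> l\<close> (lemma \<open>le_shift_peak_iff\<close>). Hence \<open>b x y \<le> l\<close> means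
  \<open>F (peak y) \<le> peak x + l\<close>, and applying \<open>F\<close> to both sides exchanges \<open>x\<close> and \<open>y\<close>; this
  is the symmetry of \<open>b\<close>. Moreover each \<open>g\<close> is the relative infimum of the functions \<open>peak y + l\<close>
  with \<open>g y \<le> l\<close>. An order-reversing involution turns this infimum into the supremum of the functions
  \<open>F (peak y) - l\<close>, which is \<open>kernel_op_bar X b g\<close>. Sesquilinearity covers finite families only, but
  this infinite infimum is harmless because an order-reversing involution respects all bounds.
\<close>

section \<open>Residuated subtraction in the extended reals\<close>

text \<open>The two conventions for \<open>\<infinity> - \<infinity>\<close> are matched so that this adjunction holds for infinite
  values as well; with a single convention on both sides it would fail.\<close>

lemma minus_bot_le_iff: "a -\<^sub>\<bottom> c \<le> d \<longleftrightarrow> a \<le> c + d"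
  unfolding minus_bot_def plus_bot_def
  by (cases a; cases c; cases d) auto

lemma minus_bot_ereal: "a -\<^sub>\<bottom> ereal l = a + ereal (- l)"
  unfolding minus_bot_def plus_bot_def by (cases a) auto

lemma minus_bot_plus_top: "a -\<^sub>\<bottom> (c + d) = (a -\<^sub>\<bottom> c) -\<^sub>\<bottom> d"
  unfolding minus_bot_def plus_bot_def
  by (cases a; cases c; cases d) auto

text \<open>An infinite \<open>c\<close> is approached by the reals above it: there are none above \<open>\<infinity>\<close>, which gives the
  empty supremum \<open>-\<infinity>\<close>, and all reals lie above \<open>-\<infinity>\<close>. This reduces subtraction of extended reals to
  shifts by real constants.\<close>

lemma ereal_le_iff_real_upper_bounds: "a \<le> c \<longleftrightarrow> (\<forall>l::real. c \<le> ereal l \<longrightarrow> a \<le> ereal l)"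
  for a c :: ereal
proof
  assume *: "\<forall>l::real. c \<le> ereal l \<longrightarrow> a \<le> ereal l"
  show "a \<le> c"
  proof (cases c)
    case MInf
    with * show ?thesis
      by (metis ereal_bot ereal_less_eq(2))
  qed (use * in auto)
qed (auto intro: order_trans)

lemma minus_bot_le_iff_shift:
  "a -\<^sub>\<bottom> c \<le> d \<longleftrightarrow> (\<forall>l::real. c \<le> ereal l \<longrightarrow> a + ereal (- l) \<le> d)"
proof -
  have "a -\<^sub>\<bottom> c \<le> d \<longleftrightarrow> a -\<^sub>\<bottom> d \<le> c"
    by (simp add: minus_bot_le_iff add.commute)
  also have "\<dots> \<longleftrightarrow> (\<forall>l::real. c \<le> ereal l \<longrightarrow> a -\<^sub>\<bottom> d \<le> ereal l)"
    by (rule ereal_le_iff_real_upper_bounds)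
  also have "\<dots> \<longleftrightarrow> (\<forall>l::real. c \<le> ereal l \<longrightarrow> a -\<^sub>\<bottom> ereal l \<le> d)"
    by (simp add: minus_bot_le_iff add.commute)
  finally show ?thesis by (simp add: minus_bot_ereal)
qed

lemma SUP_minus_bot: "(SUP y\<in>Y. u y) -\<^sub>\<bottom> c = (SUP y\<in>Y. u y -\<^sub>\<bottom> c)"
proof (rule antisym)
  have "u y \<le> c + (SUP y\<in>Y. u y -\<^sub>\<bottom> c)" if "y \<in> Y" for y
    using that by (auto simp: minus_bot_le_iff[symmetric] intro: SUP_upper)
  then show "(SUP y\<in>Y. u y) -\<^sub>\<bottom> c \<le> (SUP y\<in>Y. u y -\<^sub>\<bottom> c)"
    by (simp add: minus_bot_le_iff SUP_least)
  have "u y \<le> c + ((SUP y\<in>Y. u y) -\<^sub>\<bottom> c)" if "y \<in> Y" for y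
    using SUP_upper[OF that, of u] order_trans minus_bot_le_iff by blast
  then show "(SUP y\<in>Y. u y -\<^sub>\<bottom> c) \<le> (SUP y\<in>Y. u y) -\<^sub>\<bottom> c"
    by (auto simp: minus_bot_le_iff intro!: SUP_least)
qed

section \<open>Complete submodules\<close>

definition shift :: "'a set \<Rightarrow> ('a \<Rightarrow> ereal) \<Rightarrow> real \<Rightarrow> 'a \<Rightarrow> ereal" where
  "shift X f l = (\<lambda>x\<in>X. f x + ereal l)"

lemma ext_funs_le_iff:
  assumes "f \<in> ext_funs X" "g \<in> ext_funs X"
  shows "f \<le> g \<longleftrightarrow> (\<forall>x\<in>X. f x \<le> g x)"
proof
  assume "\<forall>x\<in>X. f x \<le> g x"
  moreover have "f x = g x" if "x \<notin> X" for x
    using assms that by (simp add: PiE_def extensional_def)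
  ultimately show "f \<le> g" by (metis le_funI order_refl)
qed (simp add: le_fun_def)

lemma pointwise_Sup_ext: "pointwise_Sup X S \<in> ext_funs X"
  by (simp add: pointwise_Sup_def)

lemma shift_ext: "shift X f l \<in> ext_funs X"
  by (simp add: shift_def)

lemma kernel_op_bar_ext: "kernel_op_bar X b f \<in> ext_funs X"
  by (simp add: kernel_op_bar_def)

lemma pointwise_Sup_le_iff:
  assumes "S \<subseteq> ext_funs X" "g \<in> ext_funs X"
  shows "pointwise_Sup X S \<le> g \<longleftrightarrow> (\<forall>f\<in>S. f \<le> g)"
proof -
  have "pointwise_Sup X S \<le> g \<longleftrightarrow> (\<forall>x\<in>X. \<forall>f\<in>S. f x \<le> g x)"
    by (simp add: ext_funs_le_iff[OF pointwise_Sup_ext assms(2)])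
      (simp add: pointwise_Sup_def SUP_le_iff)
  also have "\<dots> \<longleftrightarrow> (\<forall>f\<in>S. f \<le> g)"
    using ext_funs_le_iff[OF _ assms(2)] assms(1) by blast
  finally show ?thesis .
qed

lemma complete_submodule_ext: "complete_submodule X G \<Longrightarrow> G \<subseteq> ext_funs X"
  by (simp add: complete_submodule_def)

lemma complete_submodule_Sup:
  "complete_submodule X G \<Longrightarrow> S \<subseteq> G \<Longrightarrow> pointwise_Sup X S \<in> G"
  by (simp add: complete_submodule_def)

lemma complete_submodule_shift: "complete_submodule X G \<Longrightarrow> f \<in> G \<Longrightarrow> shift X f l \<in> G"
  by (simp add: complete_submodule_def shift_def)

lemma rel_Inf_eqI:
  assumes "m \<in> G" "\<And>h. h \<in> S \<Longrightarrow> m \<le> h"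
    and "\<And>g. g \<in> G \<Longrightarrow> (\<And>h. h \<in> S \<Longrightarrow> g \<le> h) \<Longrightarrow> g \<le> m"
  shows "rel_Inf G S = m"
  unfolding rel_Inf_def using assms by (intro Greatest_equality) auto

text \<open>The relative infimum is the supremum of the lower bounds.\<close>

lemma rel_Inf_in:
  assumes G: "complete_submodule X G" and S: "S \<subseteq> G"
  shows "rel_Inf G S \<in> G"
proof -
  let ?L = "{g\<in>G. \<forall>s\<in>S. g \<le> s}"
  let ?m = "pointwise_Sup X ?L"
  have m_G: "?m \<in> G"
    by (rule complete_submodule_Sup[OF G]) blast
  have L_ext: "?L \<subseteq> ext_funs X"
    using complete_submodule_ext[OF G] by auto
  have "rel_Inf G S = ?m"
  proof (rule rel_Inf_eqI[OF m_G])
    fix s assume "s \<in> S"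
    then show "?m \<le> s"
      using S complete_submodule_ext[OF G] pointwise_Sup_le_iff[OF L_ext, of s] by auto
  next
    fix g assume "g \<in> G" "\<And>s. s \<in> S \<Longrightarrow> g \<le> s"
    then have "g \<in> ?L" by simp
    then show "g \<le> ?m"
      using pointwise_Sup_le_iff[OF L_ext pointwise_Sup_ext, of ?L] by fast
  qed
  with m_G show ?thesis by simp
qed

section \<open>The involution defined by a symmetric kernel\<close>

text \<open>The pointwise negation is a bijection of the functions on \<open>X\<close> that carries one operator
  to the other.\<close>

lemma Rg_eq_kernel_op_bar: "Rg X b = kernel_op_bar X b ` ext_funs X"
proof -
  let ?neg = "\<lambda>f. \<lambda>x\<in>X. - f x :: ereal"
  have "kernel_op X b f = kernel_op_bar X b (?neg f)"
    "kernel_op_bar X b f = kernel_op X b (?neg f)" for f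
    by (auto simp: kernel_op_def kernel_op_bar_def minus_bot_def intro!: restrict_ext SUP_cong)
  moreover have "?neg f \<in> ext_funs X" for f by simp
  ultimately show ?thesis unfolding Rg_def by blast
qed

lemma kernel_op_bar_le_iff:
  assumes "g \<in> ext_funs X"
  shows "kernel_op_bar X b f \<le> g \<longleftrightarrow> (\<forall>x\<in>X. \<forall>y\<in>X. b x y \<le> f y + g x)"
  by (simp add: ext_funs_le_iff[OF kernel_op_bar_ext assms])
    (simp add: kernel_op_bar_def SUP_le_iff minus_bot_le_iff)

lemma kernel_op_bar_self_adjoint:
  assumes "symmetric_kernel X b" "f \<in> ext_funs X" "g \<in> ext_funs X"
  shows "kernel_op_bar X b f \<le> g \<longleftrightarrow> kernel_op_bar X b g \<le> f"
  using assms by (auto simp: kernel_op_bar_le_iff symmetric_kernel_def add.commute)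

lemma kernel_op_bar_twice_le:
  assumes "symmetric_kernel X b" "f \<in> ext_funs X"
  shows "kernel_op_bar X b (kernel_op_bar X b f) \<le> f"
  using kernel_op_bar_self_adjoint[OF assms kernel_op_bar_ext, of b f] by simp

lemma kernel_op_bar_antimono:
  assumes "symmetric_kernel X b" "f \<in> ext_funs X" "g \<in> ext_funs X" "f \<le> g"
  shows "kernel_op_bar X b g \<le> kernel_op_bar X b f"
  using order_trans[OF kernel_op_bar_twice_le[OF assms(1,2)] assms(4)]
  by (simp add: kernel_op_bar_self_adjoint[OF assms(1,3) kernel_op_bar_ext])

lemma kernel_op_bar_involutive:
  assumes sym: "symmetric_kernel X b" and "g \<in> Rg X b"
  shows "kernel_op_bar X b (kernel_op_bar X b g) = g"
proof -
  let ?B = "kernel_op_bar X b"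
  obtain f where f: "f \<in> ext_funs X" and g: "g = ?B f"
    using assms(2) by (auto simp: Rg_eq_kernel_op_bar)
  have "?B f \<le> ?B (?B (?B f))"
    by (rule kernel_op_bar_antimono[OF sym kernel_op_bar_ext f kernel_op_bar_twice_le[OF sym f]])
  then show ?thesis
    using kernel_op_bar_twice_le[OF sym kernel_op_bar_ext, of b f] g by (simp add: antisym)
qed

text \<open>The supremum \<open>h\<close> of the images of \<open>S\<close> lies in the range, so it is the image of \<open>kernel_op_bar X b h\<close>,
  and the latter is the relative infimum of \<open>S\<close>.\<close>

lemma kernel_op_bar_rel_Inf:
  assumes G: "complete_submodule X G" and sym: "symmetric_kernel X b" and Rg: "G = Rg X b"
    and S: "S \<subseteq> G"
  shows "kernel_op_bar X b (rel_Inf G S) = pointwise_Sup X (kernel_op_bar X b ` S)"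
proof -
  let ?B = "kernel_op_bar X b"
  define h where "h = pointwise_Sup X (?B ` S)"
  have ext: "g \<in> ext_funs X" if "g \<in> G" for g
    using complete_submodule_ext[OF G] that by blast
  have B_G: "?B f \<in> G" if "f \<in> ext_funs X" for f
    using that by (simp add: Rg Rg_eq_kernel_op_bar)
  have h_G: "h \<in> G"
    unfolding h_def using S ext B_G by (intro complete_submodule_Sup[OF G]) blast
  have h_le_iff: "h \<le> g \<longleftrightarrow> (\<forall>s\<in>S. ?B s \<le> g)" if "g \<in> ext_funs X" for g
  proof -
    have "?B ` S \<subseteq> ext_funs X" using kernel_op_bar_ext by (rule image_subsetI)
    then show ?thesis by (simp add: h_def pointwise_Sup_le_iff that)
  qed
  have le_Bh_iff: "g \<le> ?B h \<longleftrightarrow> (\<forall>s\<in>S. g \<le> s)" if "g \<in> G" for g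
  proof -
    \<comment> \<open>Every member of \<open>G\<close> is its own double image, so adjointness can be read in both directions.\<close>
    have swap: "u \<le> v \<longleftrightarrow> ?B v \<le> ?B u" if "u \<in> G" "v \<in> G" for u v
      using kernel_op_bar_self_adjoint[OF sym kernel_op_bar_ext ext[OF that(2)], of b u]
        kernel_op_bar_involutive[OF sym, of u] that(1) Rg by simp
    have "g \<le> ?B h \<longleftrightarrow> h \<le> ?B g"
      using swap[OF that B_G[OF ext[OF h_G]]] kernel_op_bar_involutive[OF sym, of h] h_G Rg by simp
    also have "\<dots> \<longleftrightarrow> (\<forall>s\<in>S. ?B s \<le> ?B g)"
      by (rule h_le_iff[OF kernel_op_bar_ext])
    also have "\<dots> \<longleftrightarrow> (\<forall>s\<in>S. g \<le> s)"
      using swap[OF that] S by blast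
    finally show ?thesis .
  qed
  have "rel_Inf G S = ?B h"
    using B_G[OF ext[OF h_G]] le_Bh_iff by (intro rel_Inf_eqI) auto
  then show ?thesis
    using kernel_op_bar_involutive[OF sym, of h] h_G Rg by (simp add: h_def)
qed

lemma kernel_op_bar_plus_top:
  "kernel_op_bar X b (\<lambda>x\<in>X. g x + c) = (\<lambda>x\<in>X. kernel_op_bar X b g x -\<^sub>\<bottom> c)"
  by (auto simp: kernel_op_bar_def SUP_minus_bot minus_bot_plus_top intro!: restrict_ext SUP_cong)

lemma sesquilinear_kernel_op_bar:
  assumes G: "complete_submodule X G" and sym: "symmetric_kernel X b" and Rg: "G = Rg X b"
  shows "sesquilinear X G (restrict (kernel_op_bar X b) G)"
proof -
  let ?B = "kernel_op_bar X b"
  let ?F = "restrict ?B G"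
  have B_G: "?B g \<in> G" if "g \<in> G" for g
    using that complete_submodule_ext[OF G] unfolding Rg Rg_eq_kernel_op_bar by blast
  have "?F (rel_Inf G S) = pointwise_Sup X (?F ` S)" if S: "S \<subseteq> G" for S
  proof -
    let ?h = "pointwise_Sup X (?B ` S)"
    have "?B (rel_Inf G S) = ?h"
      by (rule kernel_op_bar_rel_Inf[OF G sym Rg S])
    moreover have "rel_Inf G S \<in> G" by (rule rel_Inf_in[OF G S])
    moreover have "?F ` S = ?B ` S" using S by (auto intro!: image_cong)
    ultimately show ?thesis by simp
  qed
  then show ?thesis
    using B_G by (auto simp: sesquilinear_def kernel_op_bar_plus_top)
qed

section \<open>The kernel of an involution\<close>

definition peak :: "'a set \<Rightarrow> ('a \<Rightarrow> ereal) set \<Rightarrow> 'a \<Rightarrow> 'a \<Rightarrow> ereal" where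
  "peak X G y = pointwise_Sup X {g\<in>G. g y \<le> 0}"

lemma peak_in: "complete_submodule X G \<Longrightarrow> peak X G y \<in> G"
  unfolding peak_def by (rule complete_submodule_Sup) auto

text \<open>Shifting by \<open>-l\<close> stays inside \<open>G\<close>, which reduces the claim to \<open>l = 0\<close>, where it is
  the definition of the peak.\<close>

lemma le_shift_peak_iff:
  assumes G: "complete_submodule X G" and g: "g \<in> G" and y: "y \<in> X"
  shows "g \<le> shift X (peak X G y) l \<longleftrightarrow> g y \<le> ereal l"
proof
  assume "g \<le> shift X (peak X G y) l"
  then have "g y \<le> peak X G y y + ereal l"
    using y by (auto simp: le_fun_def shift_def dest: spec[of _ y])
  also have "peak X G y y \<le> 0"
    using y by (auto simp: peak_def pointwise_Sup_def intro: SUP_least)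
  finally show "g y \<le> ereal l" by (simp add: add_right_mono)
next
  assume le: "g y \<le> ereal l"
  have sub: "shift X g (- l) \<in> {g\<in>G. g y \<le> 0}"
    using complete_submodule_shift[OF G g, of "- l"] le y
    by (cases "g y") (auto simp: shift_def zero_ereal_def)
  have "g x \<le> peak X G y x + ereal l" if "x \<in> X" for x
  proof -
    have "shift X g (- l) x \<le> peak X G y x"
      using SUP_upper[OF sub, of "\<lambda>f. f x"] that by (simp add: peak_def pointwise_Sup_def)
    then have "g x + ereal (- l) \<le> peak X G y x"
      using that by (simp add: shift_def)
    then show ?thesis
      by (cases "g x"; cases "peak X G y x") auto
  qed
  then show "g \<le> shift X (peak X G y) l"
    using g complete_submodule_ext[OF G] shift_ext
    by (subst ext_funs_le_iff[of _ X]) (auto simp: shift_def)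
qed

text \<open>Expanding each subtraction into shifts by real constants (lemma \<open>minus_bot_le_iff_shift\<close>) writes
  \<open>kernel_op_bar X b f\<close> as a supremum of shifted columns of \<open>b\<close>; this is the form in which an
  involution of \<open>G\<close> can be compared with it.\<close>

lemma kernel_op_bar_le_iff_shift:
  assumes "g \<in> ext_funs X"
  shows "kernel_op_bar X b f \<le> g \<longleftrightarrow>
    (\<forall>y\<in>X. \<forall>l. f y \<le> ereal l \<longrightarrow> shift X (\<lambda>x. b x y) (- l) \<le> g)"
proof -
  have "kernel_op_bar X b f \<le> g \<longleftrightarrow>
    (\<forall>x\<in>X. \<forall>y\<in>X. \<forall>l. f y \<le> ereal l \<longrightarrow> b x y + ereal (- l) \<le> g x)"
    unfolding ext_funs_le_iff[OF kernel_op_bar_ext assms]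
    by (simp add: kernel_op_bar_def SUP_le_iff minus_bot_le_iff_shift)
  also have "\<dots> \<longleftrightarrow> (\<forall>y\<in>X. \<forall>l. f y \<le> ereal l \<longrightarrow> shift X (\<lambda>x. b x y) (- l) \<le> g)"
    unfolding ext_funs_le_iff[OF shift_ext assms] by (auto simp: shift_def)
  finally show ?thesis .
qed

lemma kernel_op_bar_in_submodule:
  assumes G: "complete_submodule X G" and col: "\<And>y. y \<in> X \<Longrightarrow> (\<lambda>x\<in>X. b x y) \<in> G"
  shows "kernel_op_bar X b f \<in> G"
proof -
  define S where "S = {shift X (\<lambda>x. b x y) (- l) | y l. y \<in> X \<and> f y \<le> ereal l}"
  have shift_G: "shift X (\<lambda>x. b x y) l \<in> G" if "y \<in> X" for y l
  proof -
    have "shift X (\<lambda>x. b x y) l = shift X (\<lambda>x\<in>X. b x y) l"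
      by (auto simp: shift_def)
    then show ?thesis using complete_submodule_shift[OF G col[OF that]] by simp
  qed
  have "S \<subseteq> ext_funs X" by (auto simp: S_def shift_def)
  then have "kernel_op_bar X b f \<le> g \<longleftrightarrow> pointwise_Sup X S \<le> g" if "g \<in> ext_funs X" for g
    unfolding kernel_op_bar_le_iff_shift[OF that] pointwise_Sup_le_iff[OF \<open>S \<subseteq> ext_funs X\<close> that]
    unfolding S_def by blast
  then have "kernel_op_bar X b f = pointwise_Sup X S"
    using kernel_op_bar_ext pointwise_Sup_ext by (metis antisym order_refl)
  moreover have "S \<subseteq> G" unfolding S_def using shift_G by blast
  ultimately show ?thesis using complete_submodule_Sup[OF G] by simp
qed

text \<open>If \<open>g \<le> h\<close>, then the relative infimum of \<open>{g, h}\<close> is \<open>g\<close>, hence \<open>F g\<close> is the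
  supremum of \<open>F g\<close> and \<open>F h\<close>.\<close>

lemma sesquilinear_antimono:
  assumes G: "complete_submodule X G" and F: "sesquilinear X G F"
    and gh: "g \<in> G" "h \<in> G" "g \<le> h"
  shows "F h \<le> F g"
proof -
  have "rel_Inf G {g, h} = g"
    using gh by (intro rel_Inf_eqI) auto
  moreover have "F (rel_Inf G {g, h}) = pointwise_Sup X (F ` {g, h})"
    using F gh by (simp add: sesquilinear_def)
  ultimately have eq: "pointwise_Sup X (F ` {g, h}) = F g" by simp
  have "F ` {g, h} \<subseteq> ext_funs X" "F g \<in> ext_funs X"
    using F gh complete_submodule_ext[OF G] by (auto simp: sesquilinear_def)
  from pointwise_Sup_le_iff[OF this] eq show ?thesis by simp
qed

lemma sesquilinear_shift:
  assumes "complete_submodule X G" "sesquilinear X G F" "g \<in> G"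
  shows "F (shift X g l) = shift X (F g) (- l)"
  using assms(2,3) complete_submodule_shift[OF assms(1,3), of l]
  by (simp add: sesquilinear_def shift_def minus_bot_ereal)

text \<open>The images of the peaks are the columns of the kernel. The argument rests on the
  fact \<open>F_shift_p_le\<close>: a shifted column lies below \<open>h\<close> exactly when \<open>F h\<close> lies below a constant
  at one point.\<close>

lemma involution_kernel:
  assumes G: "complete_submodule X G" and F: "sesquilinear X G F"
    and inv: "\<And>g. g \<in> G \<Longrightarrow> F (F g) = g"
  defines "b \<equiv> \<lambda>x y. F (peak X G y) x"
  shows "symmetric_kernel X b" and "G = Rg X b"
proof -
  let ?p = "peak X G" and ?B = "kernel_op_bar X b"
  have ext: "g \<in> ext_funs X" if "g \<in> G" for g
    using complete_submodule_ext[OF G] that by blast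
  have F_G: "F g \<in> G" if "g \<in> G" for g
    using F that by (auto simp: sesquilinear_def)
  have swap: "F g \<le> h \<longleftrightarrow> F h \<le> g" if "g \<in> G" "h \<in> G" for g h
    using sesquilinear_antimono[OF G F] inv F_G that by metis
  have p_G: "?p y \<in> G" and shift_p_G: "shift X (?p y) l \<in> G" for y l
    using peak_in[OF G] complete_submodule_shift[OF G] by auto
  have F_shift_p: "F (shift X (?p y) l) = shift X (\<lambda>x. b x y) (- l)" for y l
    by (simp add: sesquilinear_shift[OF G F p_G] b_def)
  have F_shift_p_le: "F (shift X (?p y) l) \<le> h \<longleftrightarrow> F h y \<le> ereal l"
    if "y \<in> X" "h \<in> G" for y l h
    using swap[OF shift_p_G that(2)] le_shift_peak_iff[OF G F_G[OF that(2)] that(1)] by simp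

  have b_le: "b y x \<le> b x y" if xy: "x \<in> X" "y \<in> X" for x y
  proof -
    have "b y x \<le> ereal l" if "b x y \<le> ereal l" for l
    proof -
      have "F (shift X (?p x) l) \<le> ?p y"
        using F_shift_p_le[OF xy(1) p_G] that by (simp add: b_def)
      then have "shift X (\<lambda>z. b z x) (- l) y \<le> ?p y y"
        unfolding F_shift_p by (rule le_funD)
      also have "\<dots> \<le> 0"
        using xy by (auto simp: peak_def pointwise_Sup_def intro: SUP_least)
      finally show ?thesis
        using xy by (cases "b y x") (auto simp: shift_def zero_ereal_def)
    qed
    then show ?thesis by (subst ereal_le_iff_real_upper_bounds) blast
  qed
  then show "symmetric_kernel X b"
    by (auto simp: symmetric_kernel_def intro: antisym)

  have "(\<lambda>x\<in>X. b x y) \<in> G" for y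
  proof -
    have "(\<lambda>x\<in>X. b x y) = F (?p y)"
      using ext[OF F_G[OF p_G]] by (auto simp: b_def PiE_def extensional_restrict)
    then show ?thesis using F_G[OF p_G] by simp
  qed
  then have B_G: "?B f \<in> G" for f
    by (rule kernel_op_bar_in_submodule[OF G])

  have F_eq_B: "F g = ?B g" if g: "g \<in> G" for g
  proof -
    \<comment> \<open>Both sides have the same upper bounds in \<open>G\<close>.\<close>
    have "?B g \<le> h \<longleftrightarrow> F g \<le> h" if h: "h \<in> G" for h
    proof -
      have "?B g \<le> h \<longleftrightarrow> (\<forall>y\<in>X. \<forall>l. g y \<le> ereal l \<longrightarrow> F (shift X (?p y) l) \<le> h)"
        by (simp add: kernel_op_bar_le_iff_shift[OF ext[OF h]] F_shift_p)
      also have "\<dots> \<longleftrightarrow> (\<forall>y\<in>X. \<forall>l. g y \<le> ereal l \<longrightarrow> F h y \<le> ereal l)"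
        using F_shift_p_le h by blast
      also have "\<dots> \<longleftrightarrow> (\<forall>y\<in>X. F h y \<le> g y)"
        using ereal_le_iff_real_upper_bounds by blast
      also have "\<dots> \<longleftrightarrow> F h \<le> g"
        by (rule ext_funs_le_iff[OF ext[OF F_G[OF h]] ext[OF g], symmetric])
      also have "\<dots> \<longleftrightarrow> F g \<le> h"
        by (rule swap[OF h g])
      finally show ?thesis .
    qed
    then show ?thesis using B_G F_G[OF g] by (metis antisym order_refl)
  qed
  have "g \<in> Rg X b" if "g \<in> G" for g
    unfolding Rg_eq_kernel_op_bar
    using F_eq_B[OF F_G[OF that]] inv[OF that] ext[OF F_G[OF that]] by (metis image_eqI)
  then show "G = Rg X b"
    using B_G by (auto simp: Rg_eq_kernel_op_bar)
qed

section \<open>The equivalence\<close>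

theorem theorem5p1:
  fixes X :: "'a set" and G :: "('a \<Rightarrow> ereal) set"
  assumes "complete_submodule X G"
  shows "((\<exists>b. symmetric_kernel X b \<and> G = Rg X b) \<longleftrightarrow>
          (\<exists>F. sesquilinear X G F \<and> (\<forall>g\<in>G. F (F g) = g))) \<and>
         (\<forall>b. symmetric_kernel X b \<and> G = Rg X b \<longrightarrow>
            (let F = restrict (kernel_op_bar X b) (Rg X b)
             in sesquilinear X G F \<and> (\<forall>g\<in>G. F (F g) = g)))"
proof -
  have kernel: "sesquilinear X G F \<and> (\<forall>g\<in>G. F (F g) = g)"
    if b: "symmetric_kernel X b" "G = Rg X b" and F: "F = restrict (kernel_op_bar X b) (Rg X b)"
    for b F
  proof
    show ses: "sesquilinear X G F"
      using sesquilinear_kernel_op_bar[OF assms b] F b(2) by simp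
    show "\<forall>g\<in>G. F (F g) = g"
    proof
      fix g assume g: "g \<in> G"
      then have "F g \<in> G" using ses by (auto simp: sesquilinear_def)
      then show "F (F g) = g"
        using kernel_op_bar_involutive[OF b(1)] g F b(2) by simp
    qed
  qed
  moreover have "\<exists>b. symmetric_kernel X b \<and> G = Rg X b"
    if "sesquilinear X G F" "\<forall>g\<in>G. F (F g) = g" for F
    using involution_kernel[OF assms that(1)] that(2) by blast
  ultimately show ?thesis unfolding Let_def by blast
qed

end
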